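(* Let $X$ be a Hausdorff space which is either Lindelöf or paracompact. Then $X$ is Stäckel-compact if and only if $X$ is compact. In particular, a metrizable space is Stäckel-compact if and only if it is compact.
   Context: Work in ZFC. A Hausdorff topological space $X$ is Stäckel-compact if there is a linear (total) order $\prec$ on the set $X$ such that every non-empty closed subset of $X$ has a $\prec$-least and a $\prec$-greatest element; $\prec$ is not assumed to be related to the topology of $X$ in any other way. *)

theory Defs
  imports "HOL-Analysis.Analysis"
begin

text \<open>
  The order is a reflexive linear order with field \<open>topspace X\<close>; the strict order of the
  literature is its irreflexive part, and least/greatest elements are the same for both.
\<close>

definition Staeckel_compact_space :: "'a topology \<Rightarrow> bool" where
  "Staeckel_compact_space X \<longleftrightarrow>
     Hausdorff_space X \<and>
     (\<exists>r. linear_order_on (topspace X) r \<and>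
          (\<forall>C. closedin X C \<and> C \<noteq> {} \<longrightarrow>
             (\<exists>l\<in>C. \<forall>x\<in>C. (l, x) \<in> r) \<and> (\<exists>g\<in>C. \<forall>x\<in>C. (x, g) \<in> r)))"

text \<open>The Hausdorff axiom is not part of this definition of paracompactness.\<close>

definition paracompact_space :: "'a topology \<Rightarrow> bool" where
  "paracompact_space X \<longleftrightarrow>
     (\<forall>\<U>. (\<forall>U\<in>\<U>. openin X U) \<and> \<Union>\<U> = topspace X \<longrightarrow>
        (\<exists>\<V>. (\<forall>V\<in>\<V>. openin X V) \<and> \<Union>\<V> = topspace X \<and>
             (\<forall>V\<in>\<V>. \<exists>U\<in>\<U>. V \<subseteq> U) \<and> locally_finite_in X \<V>))"

end

theory Submission
  imports Defs
begin

text \<open>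
  \<^emph>\<open>Compact implies Staeckel-compact.\<close>  A compact Hausdorff space is completely regular, so its
  continuous real functions separate points. Well-order these functions and compare points
  lexicographically by their values. A non-empty closed set \<open>C\<close> has a least element: minimise the
  functions over \<open>C\<close> one after the other; each stage leaves a non-empty closed set, compactness
  carries the construction through limit stages, and a point that survives all stages is least
  (\<open>lex_least_in_closed\<close>). Negating all the functions reverses the order, so the same
  argument yields greatest elements.

  \<^emph>\<open>Staeckel-compact implies compact.\<close>  In a Staeckel-compact space every infinite set has an
  accumulation point (\<open>Staeckel_infinite_imp_derived_set\<close>). Otherwise all subsets of some infinite
  set are closed, hence that set is well-ordered by an order whose converse is also a well-order,
  which forces it to be finite. Consequently every infinite family of points, possibly with
  repetitions, clusters somewhere (\<open>Staeckel_cluster_point\<close>). In a paracompact space this makes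
  locally finite open covers finite: choose a point in each non-empty member. In a Lindelof space
  it rules out a countable open cover without finite subcover: choose points outside the finite
  partial unions. For metrizable spaces the Bolzano-Weierstrass characterisation of compactness
  applies directly.
\<close>

section \<open>Lexicographic orders on compact spaces\<close>

text \<open>
  Strict lexicographic comparison by the values \<open>\<phi> i\<close>, for \<open>i \<in> I\<close>, where \<open>w\<close> is meant to be a
  reflexive well-order of \<open>I\<close>: at the first index where \<open>x\<close> and \<open>y\<close> differ, \<open>x\<close> has the smaller
  value.
\<close>

definition lex_less :: "'i rel \<Rightarrow> 'i set \<Rightarrow> ('i \<Rightarrow> 'a \<Rightarrow> real) \<Rightarrow> 'a \<Rightarrow> 'a \<Rightarrow> bool" where
  "lex_less w I \<phi> x y \<longleftrightarrow>
     (\<exists>i\<in>I. \<phi> i x < \<phi> i y \<and> (\<forall>j\<in>I. (j, i) \<in> w - Id \<longrightarrow> \<phi> j x = \<phi> j y))"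

lemma lex_less_uminus: "lex_less w I (\<lambda>i x. - \<phi> i x) x y \<longleftrightarrow> lex_less w I \<phi> y x"
  by (fastforce simp: lex_less_def)

lemma lex_less_trans:
  assumes w: "well_order_on I w" and xy: "lex_less w I \<phi> x y" and yz: "lex_less w I \<phi> y z"
  shows "lex_less w I \<phi> x z"
proof -
  obtain i where i: "i \<in> I" "\<phi> i x < \<phi> i y" "\<And>j. j \<in> I \<Longrightarrow> (j, i) \<in> w - Id \<Longrightarrow> \<phi> j x = \<phi> j y"
    using xy unfolding lex_less_def by blast
  obtain k where k: "k \<in> I" "\<phi> k y < \<phi> k z" "\<And>j. j \<in> I \<Longrightarrow> (j, k) \<in> w - Id \<Longrightarrow> \<phi> j y = \<phi> j z"
    using yz unfolding lex_less_def by blast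
  have tot: "total_on I w" and tr: "trans (w - Id)"
    using w by (auto simp: order_on_defs intro: trans_diff_Id)
  consider "i = k" | "(i, k) \<in> w - Id" | "(k, i) \<in> w - Id"
    using tot i(1) k(1) unfolding total_on_def by blast
  then show ?thesis
  proof cases
    case 1
    then show ?thesis
      unfolding lex_less_def using i k by (intro bexI[of _ i]) auto
  next
    case 2
    have "\<phi> j x = \<phi> j z" if "j \<in> I" "(j, i) \<in> w - Id" for j
      using i(3)[OF that] k(3)[OF that(1) transD[OF tr that(2) 2]] by simp
    then show ?thesis
      unfolding lex_less_def using i k(3)[OF i(1) 2] by (intro bexI[of _ i]) auto
  next
    case 3
    have "\<phi> j x = \<phi> j z" if "j \<in> I" "(j, k) \<in> w - Id" for j
      using k(3)[OF that] i(3)[OF that(1) transD[OF tr that(2) 3]] by simp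
    then show ?thesis
      unfolding lex_less_def using k i(3)[OF k(1) 3] by (intro bexI[of _ k]) auto
  qed
qed

lemma lex_less_total:
  assumes w: "well_order_on I w" and ne: "i \<in> I" "\<phi> i x \<noteq> \<phi> i y"
  shows "lex_less w I \<phi> x y \<or> lex_less w I \<phi> y x"
proof -
  have "wf (w - Id)"
    using w by (simp add: well_order_on_def)
  then obtain k where k: "k \<in> {i \<in> I. \<phi> i x \<noteq> \<phi> i y}"
    and min: "\<And>j. (j, k) \<in> w - Id \<Longrightarrow> j \<notin> {i \<in> I. \<phi> i x \<noteq> \<phi> i y}"
    using wfE_min[of "w - Id" i "{i \<in> I. \<phi> i x \<noteq> \<phi> i y}"] ne by auto
  have "\<forall>j\<in>I. (j, k) \<in> w - Id \<longrightarrow> \<phi> j x = \<phi> j y"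
    using min by blast
  then show ?thesis
    using k unfolding lex_less_def by (cases "\<phi> k x < \<phi> k y") (auto intro!: bexI[of _ k])
qed

text \<open>Compactness for a chain of closed sets: this handles the limit stages.\<close>

lemma compact_space_chain_Inter_nonempty:
  assumes X: "compact_space X" and C: "closedin X C" "C \<noteq> {}"
    and K: "\<And>j. j \<in> J \<Longrightarrow> closedin X (K j) \<and> K j \<noteq> {} \<and> K j \<subseteq> C"
    and chain: "\<And>i j. i \<in> J \<Longrightarrow> j \<in> J \<Longrightarrow> K i \<subseteq> K j \<or> K j \<subseteq> K i"
  shows "C \<inter> (\<Inter>j\<in>J. K j) \<noteq> {}"
proof -
  have fin: "\<Inter>F \<noteq> {}" if "finite F" "F \<subseteq> insert C (K ` J)" for F
  proof (cases "F = {}")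
    case False
    have "A \<subseteq> B \<or> B \<subseteq> A" if "A \<in> insert C (K ` J)" "B \<in> insert C (K ` J)" for A B
      using that K chain by blast
    then have "\<forall>A\<in>F. \<forall>B\<in>F. A \<subseteq> B \<or> B \<subseteq> A"
      using that(2) by (meson subsetD)
    then have "subset.chain UNIV F"
      by (simp add: subset_chain_def)
    then have "\<Inter>F \<in> F"
      using Inter_in_chain[OF that(1) False] by blast
    then have "\<Inter>F \<in> insert C (K ` J)"
      using that(2) by (rule rev_subsetD)
    then show ?thesis
      using K C(2) by (metis image_iff insert_iff)
  qed simp
  have "\<forall>A\<in>insert C (K ` J). closedin X A"
    using C(1) K by blast
  then have "\<Inter>(insert C (K ` J)) \<noteq> {}"
    using X fin unfolding compact_space_fip by metis
  then show ?thesis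
    by simp
qed

lemma lex_least_in_closed:
  assumes X: "compact_space X" and w: "well_order_on I w"
    and cont: "\<And>i. i \<in> I \<Longrightarrow> continuous_map X euclideanreal (\<phi> i)"
    and C: "closedin X C" "C \<noteq> {}"
  shows "\<exists>l\<in>C. \<forall>x\<in>C. \<not> lex_less w I \<phi> x l"
proof -
  have tot: "total_on I w" and tr: "trans w" and refl: "refl_on I w" and anti: "antisym w"
    and wf: "wf (w - Id)"
    using w by (auto simp: order_on_defs)
  define agree where "agree i x y \<longleftrightarrow> (\<forall>j\<in>I. (j, i) \<in> w - Id \<longrightarrow> \<phi> j x = \<phi> j y)" for i x y
  \<comment> \<open>The points of \<open>C\<close> that survive the minimisation up to and including stage \<open>i\<close>.\<close>
  define K where
    "K i = {x \<in> C. \<forall>j\<in>I. (j, i) \<in> w \<longrightarrow> (\<forall>y\<in>C. agree j y x \<longrightarrow> \<phi> j x \<le> \<phi> j y)}" for i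
  have anti_K: "K i \<subseteq> K j" if "(j, i) \<in> w" for i j
    using that tr unfolding K_def trans_def by blast
  have chain: "K i \<subseteq> K j \<or> K j \<subseteq> K i" if "i \<in> I" "j \<in> I" for i j
    using tot that anti_K unfolding total_on_def by (cases "i = j") blast+
  have stage: "closedin X (K i) \<and> K i \<noteq> {}" if "i \<in> I" for i
    using wf that
  proof (induction i rule: wf_induct_rule)
    case (less i)
    define J where "J = {j \<in> I. (j, i) \<in> w - Id}"
    define L where "L = C \<inter> (\<Inter>j\<in>J. K j)"
    have clo_K: "closedin X (K j) \<and> K j \<noteq> {} \<and> K j \<subseteq> C" if "j \<in> J" for j
      using less that by (auto simp: J_def K_def)
    have L_ne: "L \<noteq> {}"
      unfolding L_def using X C clo_K
      by (rule compact_space_chain_Inter_nonempty) (use chain in \<open>auto simp: J_def\<close>)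
    have L_clo: "closedin X L"
      unfolding L_def
      using C clo_K by (cases "J = {}") (auto intro!: closedin_Int closedin_INT)
    \<comment> \<open>All points surviving the stages before \<open>i\<close> have the same values at those stages, so
      minimality of \<open>x\<close> at stage \<open>i\<close> may be tested against all of \<open>L\<close> (\<open>K_eq\<close> below).\<close>
    have L_agree: "agree i x y" if "x \<in> L" "y \<in> L" for x y
    proof -
      have "j \<in> I \<longrightarrow> (j, i) \<in> w - Id \<longrightarrow> \<phi> j x = \<phi> j y" for j
        using wf
      proof (induction j rule: wf_induct_rule)
        case (less j)
        show ?case
        proof (intro impI)
          assume j: "j \<in> I" "(j, i) \<in> w - Id"
          have "(k, i) \<in> w - Id" if "(k, j) \<in> w - Id" for k
            using that j(2) transD[OF trans_diff_Id[OF tr anti]] by blast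
          then have ag: "agree j x y" "agree j y x"
            using less.IH unfolding agree_def by (metis)+
          have "x \<in> K j" "y \<in> K j" "x \<in> C" "y \<in> C" "(j, j) \<in> w"
            using that j refl by (auto simp: L_def J_def refl_on_def)
          then show "\<phi> j x = \<phi> j y"
            using ag j(1) unfolding K_def by (simp add: order_antisym)
        qed
      qed
      then show ?thesis
        by (simp add: agree_def)
    qed
    have L_closed_under_agree: "y \<in> L" if x: "x \<in> L" and y: "y \<in> C" "agree i y x" for x y
    proof -
      have "y \<in> K j" if j: "j \<in> J" for j
      proof -
        have "\<phi> k y \<le> \<phi> k z" if k: "k \<in> I" "(k, j) \<in> w" and z: "z \<in> C" "agree k z y" for k z
        proof -
          have ki: "(k, i) \<in> w - Id"
            using k j tr anti unfolding J_def trans_def antisym_def by blast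
          have "(m, i) \<in> w - Id" if "(m, k) \<in> w - Id" for m
            using that ki transD[OF trans_diff_Id[OF tr anti]] by blast
          then have "agree k z x"
            using z(2) y(2) by (auto simp: agree_def)
          moreover have "x \<in> K j"
            using x j by (auto simp: L_def)
          ultimately have "\<phi> k x \<le> \<phi> k z"
            using k z(1) by (auto simp: K_def)
          then show ?thesis
            using y(2) k(1) ki by (simp add: agree_def)
        qed
        then show ?thesis
          using y(1) by (auto simp: K_def)
      qed
      then show ?thesis
        using y(1) by (auto simp: L_def)
    qed
    have "compactin X L"
      using X L_clo by (rule closedin_compact_space)
    then have "compact (\<phi> i ` L)"
      using image_compactin[OF _ cont[OF less.prems]] by simp
    then obtain m where m: "m \<in> L" and m_le: "\<And>x. x \<in> L \<Longrightarrow> \<phi> i m \<le> \<phi> i x"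
      using compact_attains_inf[of "\<phi> i ` L"] L_ne by auto
    \<comment> \<open>Stage \<open>i\<close> keeps exactly the minimum points of \<open>\<phi> i\<close> on \<open>L\<close>, which form a closed set.\<close>
    have K_eq: "K i = L \<inter> {x \<in> topspace X. \<phi> i x \<in> {..\<phi> i m}}"
    proof (intro equalityI subsetI)
      fix x assume x: "x \<in> K i"
      have xL: "x \<in> L"
      proof -
        have "x \<in> K j" if "j \<in> J" for j
          using x anti_K that unfolding J_def by blast
        then show ?thesis
          using x by (auto simp: L_def K_def)
      qed
      then have "\<phi> i x \<le> \<phi> i m"
        using x m L_agree[OF m xL] less.prems refl
        by (auto simp: K_def L_def refl_on_def)
      then show "x \<in> L \<inter> {x \<in> topspace X. \<phi> i x \<in> {..\<phi> i m}}"
        using xL closedin_subset[OF L_clo] by auto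
    next
      fix x assume "x \<in> L \<inter> {x \<in> topspace X. \<phi> i x \<in> {..\<phi> i m}}"
      then have x: "x \<in> L" "\<phi> i x \<le> \<phi> i m"
        by auto
      have "\<phi> j x \<le> \<phi> j y" if j: "j \<in> I" "(j, i) \<in> w" and y: "y \<in> C" "agree j y x" for j y
      proof (cases "j = i")
        case True
        then show ?thesis
          using L_closed_under_agree[OF x(1) y(1)] y(2) m_le x(2) by fastforce
      next
        case False
        then have "x \<in> K j"
          using x(1) j by (auto simp: L_def J_def)
        then show ?thesis
          using j y refl by (auto simp: K_def refl_on_def)
      qed
      then show "x \<in> K i"
        using x(1) by (auto simp: K_def L_def)
    qed
    have "closedin X {x \<in> topspace X. \<phi> i x \<in> {..\<phi> i m}}"
      by (rule closedin_continuous_map_preimage[OF cont[OF less.prems]]) simp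
    moreover have "m \<in> K i"
      unfolding K_eq using m closedin_subset[OF L_clo] by auto
    ultimately show ?case
      using L_clo unfolding K_eq by blast
  qed
  have "C \<inter> (\<Inter>i\<in>I. K i) \<noteq> {}"
    using X C by (rule compact_space_chain_Inter_nonempty) (use stage chain in \<open>auto simp: K_def\<close>)
  then obtain l where l: "l \<in> C" "\<And>i. i \<in> I \<Longrightarrow> l \<in> K i"
    by blast
  have "\<not> lex_less w I \<phi> x l" if "x \<in> C" for x
  proof
    assume "lex_less w I \<phi> x l"
    then obtain i where "i \<in> I" "\<phi> i x < \<phi> i l" "agree i x l"
      unfolding lex_less_def agree_def by blast
    moreover have "(i, i) \<in> w"
      using refl \<open>i \<in> I\<close> by (simp add: refl_on_def)
    ultimately show False
      using l(2)[OF \<open>i \<in> I\<close>] that unfolding K_def by force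
  qed
  then show ?thesis
    using l(1) by blast
qed

theorem compact_Hausdorff_imp_Staeckel:
  assumes X: "compact_space X" "Hausdorff_space X"
  shows "Staeckel_compact_space X"
proof -
  define I where "I = {f. continuous_map X euclideanreal f}"
  \<comment> \<open>The functions index themselves.\<close>
  define \<phi> :: "('a \<Rightarrow> real) \<Rightarrow> 'a \<Rightarrow> real" where "\<phi> f = f" for f
  obtain w where w: "well_order_on I w"
    using well_order_on by blast
  have sep: "\<exists>f\<in>I. \<phi> f x \<noteq> \<phi> f y" if "x \<in> topspace X" "y \<in> topspace X" "x \<noteq> y" for x y
  proof -
    have "completely_regular_space X"
      using X by (simp add: compact_Hausdorff_or_regular_imp_normal_space
          normal_imp_completely_regular_space)
    moreover have "closedin X {y}"
      using X that by (simp add: closedin_Hausdorff_singleton)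
    moreover have "x \<in> topspace X - {y}"
      using that by simp
    ultimately obtain f :: "'a \<Rightarrow> real"
      where "continuous_map X (top_of_set {0..1}) f" "f x = 0" "f ` {y} \<subseteq> {1}"
      unfolding completely_regular_space_def by meson
    then show ?thesis
      unfolding I_def \<phi>_def by (intro bexI[of _ f]) (auto simp: continuous_map_in_subtopology)
  qed
  have total: "lex_less w I \<phi> x y \<or> lex_less w I \<phi> y x"
    if "x \<in> topspace X" "y \<in> topspace X" "x \<noteq> y" for x y
    using sep[OF that] lex_less_total[OF w, of _ \<phi> x y] by auto
  have irrefl: "\<not> lex_less w I \<phi> x x" for x
    by (simp add: lex_less_def)
  define r where
    "r = {(x, y). x \<in> topspace X \<and> y \<in> topspace X \<and> (x = y \<or> lex_less w I \<phi> x y)}"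
  have "trans r"
    unfolding r_def by (intro transI) (auto intro: lex_less_trans[OF w])
  moreover have "antisym r"
  proof (intro antisymI)
    fix x y assume "(x, y) \<in> r" "(y, x) \<in> r"
    then show "x = y"
      using lex_less_trans[OF w, of \<phi> x y x] irrefl[of x] by (auto simp: r_def)
  qed
  moreover have "r \<subseteq> topspace X \<times> topspace X" "refl_on (topspace X) r" "total_on (topspace X) r"
    using total by (auto simp: r_def refl_on_def total_on_def)
  ultimately have "linear_order_on (topspace X) r"
    by (simp add: order_on_defs)
  moreover have "(\<exists>l\<in>C. \<forall>x\<in>C. (l, x) \<in> r) \<and> (\<exists>g\<in>C. \<forall>x\<in>C. (x, g) \<in> r)"
    if C: "closedin X C" "C \<noteq> {}" for C
  proof -
    have sub: "C \<subseteq> topspace X"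
      using C(1) by (rule closedin_subset)
    obtain l where "l \<in> C" "\<forall>x\<in>C. \<not> lex_less w I \<phi> x l"
      using lex_least_in_closed[OF X(1) w _ C, of \<phi>] by (auto simp: I_def \<phi>_def)
    moreover obtain g where "g \<in> C" "\<forall>x\<in>C. \<not> lex_less w I (\<lambda>i x. - \<phi> i x) x g"
      using lex_least_in_closed[OF X(1) w _ C, of "\<lambda>i x. - \<phi> i x"]
      by (auto simp: I_def \<phi>_def continuous_map_minus)
    ultimately show ?thesis
      using total sub unfolding r_def lex_less_uminus by blast
  qed
  ultimately show ?thesis
    using X(2) unfolding Staeckel_compact_space_def by blast
qed

section \<open>Accumulation points in Staeckel-compact spaces\<close>

text \<open>
  A linearly ordered set all of whose non-empty subsets have least and greatest elements is finite:
  otherwise the elements with finitely many predecessors have a greatest one, and its immediate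
  successor also has finitely many predecessors.
\<close>

lemma finite_if_subsets_have_least_and_greatest:
  assumes ord: "antisym r" "trans r"
    and least: "\<And>C. C \<subseteq> S \<Longrightarrow> C \<noteq> {} \<Longrightarrow> \<exists>l\<in>C. \<forall>x\<in>C. (l, x) \<in> r"
    and greatest: "\<And>C. C \<subseteq> S \<Longrightarrow> C \<noteq> {} \<Longrightarrow> \<exists>g\<in>C. \<forall>x\<in>C. (x, g) \<in> r"
  shows "finite S"
proof (rule ccontr)
  assume inf: "infinite S"
  define down where "down x = {y \<in> S. (y, x) \<in> r}" for x
  define A where "A = {x \<in> S. finite (down x)}"
  obtain l where l: "l \<in> S" "\<forall>x\<in>S. (l, x) \<in> r"
    using least[of S] inf by auto
  then have "down l \<subseteq> {l}"
    using ord(1) unfolding down_def antisym_def by blast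
  then have "l \<in> A"
    using l finite_subset unfolding A_def by blast
  then obtain g where g: "g \<in> A" "\<forall>x\<in>A. (x, g) \<in> r"
    using greatest[of A] by (auto simp: A_def)
  then have "infinite (S - down g)"
    using inf by (auto simp: A_def)
  then have "S - down g \<noteq> {}"
    by force
  then obtain m where m: "m \<in> S - down g" "\<forall>x\<in>S - down g. (m, x) \<in> r"
    using least[of "S - down g"] by blast
  have "down m \<subseteq> insert m (down g)"
    using m ord(1) unfolding down_def antisym_def by blast
  then have "m \<in> A"
    using m g finite_subset unfolding A_def by blast
  then show False
    using g m by (auto simp: down_def)
qed

lemma Staeckel_infinite_imp_derived_set:
  assumes X: "Staeckel_compact_space X" and S: "S \<subseteq> topspace X" "infinite S"
  shows "X derived_set_of S \<noteq> {}"
proof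
  assume empty: "X derived_set_of S = {}"
  obtain r where r: "linear_order_on (topspace X) r"
    and ext: "\<And>C. closedin X C \<Longrightarrow> C \<noteq> {} \<Longrightarrow>
             (\<exists>l\<in>C. \<forall>x\<in>C. (l, x) \<in> r) \<and> (\<exists>g\<in>C. \<forall>x\<in>C. (x, g) \<in> r)"
    using X unfolding Staeckel_compact_space_def by blast
  have "closedin X C" if "C \<subseteq> S" for C
    using derived_set_of_mono[OF that, of X] empty S(1) that
    by (auto simp: closedin_contains_derived_set)
  then have "finite S"
    using r ext by (intro finite_if_subsets_have_least_and_greatest[of r]) (auto simp: order_on_defs)
  then show False
    using S(2) by simp
qed

lemma Staeckel_cluster_point:
  assumes X: "Staeckel_compact_space X" and I: "infinite I"
    and f: "\<And>i. i \<in> I \<Longrightarrow> f i \<in> topspace X"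
  shows "\<exists>p\<in>topspace X. \<forall>U. openin X U \<and> p \<in> U \<longrightarrow> infinite {i \<in> I. f i \<in> U}"
proof (cases "finite (f ` I)")
  case True
  then obtain k where k: "k \<in> I" "infinite {i \<in> I. f i = f k}"
    using pigeonhole_infinite[OF I] by blast
  have "infinite {i \<in> I. f i \<in> U}" if "f k \<in> U" for U
  proof
    assume fin: "finite {i \<in> I. f i \<in> U}"
    have "{i \<in> I. f i = f k} \<subseteq> {i \<in> I. f i \<in> U}"
      using that by auto
    then show False
      using k(2) fin finite_subset by blast
  qed
  then show ?thesis
    using f[OF k(1)] by blast
next
  case False
  then obtain p where p: "p \<in> X derived_set_of (f ` I)"
    using Staeckel_infinite_imp_derived_set[OF X, of "f ` I"] f by blast
  have "t1_space X"
    using X by (simp add: Staeckel_compact_space_def Hausdorff_imp_t1_space)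
  then have p': "p \<in> topspace X" "\<And>U. p \<in> U \<Longrightarrow> openin X U \<Longrightarrow> infinite (f ` I \<inter> U)"
    using p by (auto simp: t1_space_derived_set_of_infinite_openin)
  have "infinite {i \<in> I. f i \<in> U}" if "openin X U" "p \<in> U" for U
  proof
    assume "finite {i \<in> I. f i \<in> U}"
    then have "finite (f ` {i \<in> I. f i \<in> U})"
      by (rule finite_imageI)
    moreover have "f ` {i \<in> I. f i \<in> U} = f ` I \<inter> U"
      by auto
    ultimately show False
      using p'(2)[OF that(2,1)] by simp
  qed
  then show ?thesis
    using p'(1) by blast
qed

section \<open>From Staeckel-compactness to compactness\<close>

theorem Staeckel_Lindelof_imp_compact:
  assumes X: "Staeckel_compact_space X" "Lindelof_space X"
  shows "compact_space X"
  unfolding compact_space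
proof (intro allI impI, rule ccontr)
  fix \<U> assume \<U>: "(\<forall>U\<in>\<U>. openin X U) \<and> \<Union>\<U> = topspace X"
    and nofin: "\<nexists>\<F>. finite \<F> \<and> \<F> \<subseteq> \<U> \<and> \<Union>\<F> = topspace X"
  obtain \<V> where V: "countable \<V>" "\<V> \<subseteq> \<U>" "\<Union>\<V> = topspace X"
    using X(2) \<U> unfolding Lindelof_space_def by meson
  have "infinite \<V>"
    using nofin V(2,3) by metis
  then have "\<V> \<noteq> {}"
    by auto
  then obtain e :: "nat \<Rightarrow> 'a set" where e: "range e = \<V>"
    using V(1) range_from_nat_into[of \<V>] \<open>\<V> \<noteq> {}\<close> by metis
  have "\<exists>x. x \<in> topspace X - \<Union>(e ` {..n})" for n
  proof -
    have "e ` {..n} \<subseteq> \<U>"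
      using e V(2) by blast
    moreover have "\<Union>(e ` {..n}) \<subseteq> topspace X"
      using e V(3) by blast
    moreover have "\<Union>(e ` {..n}) \<noteq> topspace X"
      using nofin calculation(1) by (metis finite_atMost finite_imageI)
    ultimately show ?thesis
      by blast
  qed
  then obtain x where x: "\<And>n. x n \<in> topspace X - \<Union>(e ` {..n})"
    by metis
  then obtain p where p: "p \<in> topspace X"
    and cluster: "\<And>U. openin X U \<Longrightarrow> p \<in> U \<Longrightarrow> infinite {n \<in> UNIV. x n \<in> U}"
    using Staeckel_cluster_point[OF X(1) infinite_UNIV_nat, of x] by blast
  obtain n where n: "p \<in> e n"
    using p e V(3) by blast
  \<comment> \<open>The set \<open>e n\<close> contains only those \<open>x i\<close> with \<open>i < n\<close>.\<close>
  have "{i \<in> UNIV. x i \<in> e n} \<subseteq> {..<n}"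
    using x by (force simp: not_less[symmetric])
  then have "finite {i \<in> UNIV. x i \<in> e n}"
    by (rule finite_subset) simp
  moreover have "openin X (e n)"
    using \<U> V(2) e by blast
  ultimately show False
    using cluster n by blast
qed

theorem Staeckel_paracompact_imp_compact:
  assumes X: "Staeckel_compact_space X" "paracompact_space X"
  shows "compact_space X"
  unfolding compact_space
proof (intro allI impI)
  fix \<U> assume \<U>: "(\<forall>U\<in>\<U>. openin X U) \<and> \<Union>\<U> = topspace X"
  obtain \<V> where V: "\<Union>\<V> = topspace X" "\<And>V. V \<in> \<V> \<Longrightarrow> \<exists>U\<in>\<U>. V \<subseteq> U" "locally_finite_in X \<V>"
    using X(2) \<U> unfolding paracompact_space_def by meson
  \<comment> \<open>The empty set may belong to the refinement, but contains no point to choose.\<close>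
  define \<W> where "\<W> = \<V> - {{}}"
  have "\<exists>x. x \<in> V" if "V \<in> \<W>" for V
    using that by (auto simp: \<W>_def)
  then obtain f where f: "\<And>V. V \<in> \<W> \<Longrightarrow> f V \<in> V"
    by metis
  have fin: "finite \<W>"
  proof (rule ccontr)
    assume inf: "infinite \<W>"
    have "f V \<in> topspace X" if "V \<in> \<W>" for V
      using f[OF that] that V(1) by (auto simp: \<W>_def)
    then obtain p where p: "p \<in> topspace X"
      and cluster: "\<And>U. openin X U \<Longrightarrow> p \<in> U \<Longrightarrow> infinite {V \<in> \<W>. f V \<in> U}"
      using Staeckel_cluster_point[OF X(1) inf, of f] by blast
    obtain U where U: "openin X U" "p \<in> U" "finite {V \<in> \<V>. V \<inter> U \<noteq> {}}"
      using V(3) p unfolding locally_finite_in_def by blast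
    have "{V \<in> \<W>. f V \<in> U} \<subseteq> {V \<in> \<V>. V \<inter> U \<noteq> {}}"
      using f by (auto simp: \<W>_def)
    then show False
      using cluster[OF U(1,2)] U(3) finite_subset by blast
  qed
  obtain u where u: "\<And>V. V \<in> \<V> \<Longrightarrow> u V \<in> \<U> \<and> V \<subseteq> u V"
    using V(2) by metis
  have "topspace X \<subseteq> \<Union>(u ` \<W>)"
    using V(1) u by (fastforce simp: \<W>_def)
  moreover have "u ` \<W> \<subseteq> \<U>"
    using u by (auto simp: \<W>_def)
  ultimately have "\<Union>(u ` \<W>) = topspace X"
    using \<U> by (metis Union_mono subset_antisym)
  then show "\<exists>\<F>. finite \<F> \<and> \<F> \<subseteq> \<U> \<and> \<Union>\<F> = topspace X"
    using fin \<open>u ` \<W> \<subseteq> \<U>\<close> by (intro exI[of _ "u ` \<W>"]) simp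
qed

theorem Staeckel_metrizable_imp_compact:
  assumes X: "Staeckel_compact_space X" "metrizable_space X"
  shows "compact_space X"
proof -
  obtain M d where M: "Metric_space M d" "Metric_space.mtopology M d = X"
    using X(2) unfolding metrizable_space_def by metis
  interpret Metric_space M d
    by (rule M(1))
  show ?thesis
    using Staeckel_infinite_imp_derived_set[OF X(1)]
      compact_space_eq_Bolzano_Weierstrass topspace_mtopology
    unfolding M(2) by metis
qed

theorem corollary3p4:
  fixes X :: "'a topology" and Y :: "'b topology"
  shows "(Hausdorff_space X \<and> (Lindelof_space X \<or> paracompact_space X) \<longrightarrow>
            (Staeckel_compact_space X \<longleftrightarrow> compact_space X)) \<and>
         (metrizable_space Y \<longrightarrow> (Staeckel_compact_space Y \<longleftrightarrow> compact_space Y))"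
  using compact_Hausdorff_imp_Staeckel Staeckel_Lindelof_imp_compact
    Staeckel_paracompact_imp_compact Staeckel_metrizable_imp_compact
    metrizable_imp_Hausdorff_space
  by metis

end
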